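(* Let $A,B,C$ be real symmetric $d\times d$ matrices with $A$ positive definite and $C$ positive semi-definite, nonzero, and with nontrivial kernel. Assume $\operatorname{Ker}(B)\cap\operatorname{Ker}(C)=\{0\}$. Then: (i) $\lim_{t\to\infty}\lambda_j^t=+\infty$ for $J_++1\le j\le J_++J_\infty$; (ii) $\lim_{t\to\infty}\lambda_j^t=\lambda_j$ for $1\le j\le J_+$; (iii) $\lim_{t\to\infty}\lambda_{-j}^t=0$ for $1\le j\le\operatorname{rank}(C)$; (iv) $\lim_{t\to\infty}\lambda_{-j}^t=\lambda_{-(j-\operatorname{rank}(C))}$ for $\operatorname{rank}(C)+1\le j\le\operatorname{rank}(C)+J_-$.
   Context: Let $B^t=B-tC$ for $t\in\mathbb R$, and $\mathbf a(u,v)=u\cdot(Av)$, $\mathbf b(u,v)=u\cdot(Bv)$, $\mathbf c(u,v)=u\cdot(Cv)$. $\lambda_j^t$ (resp. $\lambda_{-j}^t$), $j\ge1$, is the $j$-th positive eigenvalue in increasing order (resp. $j$-th negative eigenvalue in decreasing order), counted with multiplicity, of the matrix pencil problem $Av=\lambda B^tv$, $v\in\mathbb R^d\setminus\{0\}$, $\lambda\in\mathbb R$. The limiting problem $(\operatorname{Ker}(C),\mathbf a,\mathbf b)$ is: find $\lambda\in\mathbb R$ and $u\in\operatorname{Ker}(C)\setminus\{0\}$ with $\mathbf a(u,v)=\lambda\mathbf b(u,v)$ for all $v\in\operatorname{Ker}(C)$; its positive and negative eigenvalues, enumerated in the same way with multiplicity, are $\lambda_j$ and $\lambda_{-j}$.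 $J_+$ and $J_-$ are the numbers of positive and negative eigenvalues of the limiting problem, and $J_\infty=\dim\{u\in\operatorname{Ker}(C):\mathbf b(u,v)=0\ \forall v\in\operatorname{Ker}(C)\}$. Each limit statement includes that the eigenvalue exists for all sufficiently large $t$. *)

theory Defs
  imports "HOL-Analysis.Analysis"
begin

definition pos_def :: "real^'n^'n \<Rightarrow> bool" where
  "pos_def M \<longleftrightarrow> (\<forall>v. v \<noteq> 0 \<longrightarrow> 0 < v \<bullet> (M *v v))"

definition pos_semidef :: "real^'n^'n \<Rightarrow> bool" where
  "pos_semidef M \<longleftrightarrow> (\<forall>v. 0 \<le> v \<bullet> (M *v v))"

definition Ker :: "real^'n^'n \<Rightarrow> (real^'n) set" where
  "Ker M = {v. M *v v = 0}"

definition form :: "real^'n^'n \<Rightarrow> real^'n \<Rightarrow> real^'n \<Rightarrow> real" where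
  "form M u v = u \<bullet> (M *v v)"

definition pencil_space :: "real^'n^'n \<Rightarrow> real^'n^'n \<Rightarrow> real \<Rightarrow> (real^'n) set" where
  "pencil_space A M l = {v. A *v v = l *\<^sub>R (M *v v)}"

definition form_space ::
    "(real^'n) set \<Rightarrow> (real^'n \<Rightarrow> real^'n \<Rightarrow> real) \<Rightarrow> (real^'n \<Rightarrow> real^'n \<Rightarrow> real)
      \<Rightarrow> real \<Rightarrow> (real^'n) set" where
  "form_space V a b l = {u \<in> V. \<forall>v\<in>V. a u v = l * b u v}"

text \<open>
  In the following, \<open>E l\<close> is the space of eigenvectors for \<open>l\<close> (together with 0), as given by
  \<^const>\<open>pencil_space\<close> or \<^const>\<open>form_space\<close>. Multiplicity is the dimension of \<open>E l\<close>. When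
  the form of \<open>A\<close> is an inner product, eigenvectors for different eigenvalues are orthogonal with
  respect to it, so there are only finitely many eigenvalues; \<^const>\<open>sorted_list_of_set\<close> is
  only meaningful on finite sets.
\<close>

definition eigenvalues :: "(real \<Rightarrow> (real^'n) set) \<Rightarrow> real set" where
  "eigenvalues E = {l. \<exists>v\<in>E l. v \<noteq> 0}"

definition pos_list :: "(real \<Rightarrow> (real^'n) set) \<Rightarrow> real list" where
  "pos_list E = concat (map (\<lambda>l. replicate (dim (E l)) l)
     (sorted_list_of_set {l \<in> eigenvalues E. 0 < l}))"

definition neg_list :: "(real \<Rightarrow> (real^'n) set) \<Rightarrow> real list" where
  "neg_list E = concat (map (\<lambda>l. replicate (dim (E l)) l)
     (rev (sorted_list_of_set {l \<in> eigenvalues E. l < 0})))"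

definition num_pos :: "(real \<Rightarrow> (real^'n) set) \<Rightarrow> nat" where
  "num_pos E = length (pos_list E)"

definition num_neg :: "(real \<Rightarrow> (real^'n) set) \<Rightarrow> nat" where
  "num_neg E = length (neg_list E)"

text \<open>
  The \<open>j\<close>-th positive and \<open>j\<close>-th negative eigenvalue, counting from \<open>j = 1\<close>. They exist
  only for \<open>j \<le> num_pos E\<close> and \<open>j \<le> num_neg E\<close> respectively, and are unspecified beyond that.
\<close>

definition pos_eig :: "(real \<Rightarrow> (real^'n) set) \<Rightarrow> nat \<Rightarrow> real" where
  "pos_eig E j = pos_list E ! (j - 1)"

definition neg_eig :: "(real \<Rightarrow> (real^'n) set) \<Rightarrow> nat \<Rightarrow> real" where
  "neg_eig E j = neg_list E ! (j - 1)"

definition J_inf :: "real^'n^'n \<Rightarrow> real^'n^'n \<Rightarrow> nat" where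
  "J_inf B C = dim {u \<in> Ker C. \<forall>v\<in>Ker C. form B u v = 0}"

end

theory Submission
  imports Defs
begin

text \<open>
  Put \<open>\<mu> = 1/\<lambda>\<close>: the \<open>\<mu>\<close> are the eigenvalues of the form of \<open>B - t C\<close> relative to the inner
  product given by \<open>A\<close>. By diagonalisation, the number of \<open>\<mu> > s\<close> is the largest dimension of a
  subspace on which \<open>B - t C - s A\<close> is positive definite, and the same holds on \<open>Ker C\<close> for
  \<open>B - s A\<close>. For large \<open>t\<close> the penalty \<open>t C\<close> dominates on every subspace on whose intersection with
  \<open>Ker C\<close> the form \<open>B - s A\<close> is negative definite; adding a complement of \<open>Ker C\<close> to such
  subspaces of \<open>Ker C\<close> compares the two counts, and the limits follow. Negative eigenvalues are the
  positive ones for \<open>- (B - t C)\<close>, up to sign. That the zero eigenvalues \<open>\<mu>\<close> of the limiting problem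
  are approached from above, which yields the eigenvalues tending to infinity, is where
  \<open>Ker B \<inter> Ker C = {0}\<close> enters.
\<close>

lemma form_add_left: "form M (u + u') v = form M u v + form M u' v"
  by (simp add: form_def inner_add_left)

lemma form_add_right: "form M u (v + v') = form M u v + form M u v'"
  by (simp add: form_def inner_add_right matrix_vector_right_distrib)

lemma form_scale_left: "form M (r *\<^sub>R u) v = r * form M u v"
  by (simp add: form_def)

lemma form_scale_right: "form M u (r *\<^sub>R v) = r * form M u v"
  by (simp add: form_def matrix_vector_mult_scaleR)

lemma form_zero [simp]: "form M 0 v = 0" "form M u 0 = 0"
  by (simp_all add: form_def)

lemma form_sum_left: "form M (\<Sum>v\<in>S. f v) w = (\<Sum>v\<in>S. form M (f v) w)"
  by (simp add: form_def inner_sum_left)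

lemma form_commute: "transpose M = M \<Longrightarrow> form M u v = form M v u"
  by (metis form_def dot_lmul_matrix inner_commute transpose_matrix_vector)

lemma form_matrix_diff: "form (M - N) u v = form M u v - form N u v"
  by (simp add: form_def inner_diff_right matrix_vector_mult_diff_rdistrib)

lemma form_matrix_scale: "form (r *\<^sub>R M) u v = r * form M u v"
  by (simp add: form_def scaleR_matrix_vector_assoc[symmetric])

lemma form_matrix_minus: "form (- M) u v = - form M u v"
  using form_matrix_scale[of "-1" M u v] by simp

lemmas form_matrix_simps = form_matrix_diff form_matrix_scale form_matrix_minus

lemma continuous_on_form: "continuous_on S (\<lambda>u. form M u u)"
  unfolding form_def by (intro continuous_intros matrix_vector_mult_linear_continuous_on)

lemma pos_def_form: "pos_def A \<Longrightarrow> v \<noteq> 0 \<Longrightarrow> 0 < form A v v"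
  by (simp add: pos_def_def form_def)

lemma form_null_of_semidefinite:
  assumes "transpose M = M" "subspace V" "\<And>v. v \<in> V \<Longrightarrow> 0 \<le> form M v v"
    and u: "u \<in> V" "form M u u = 0" and w: "w \<in> V"
  shows "form M u w = 0"
proof (rule ccontr)
  assume n: "form M u w \<noteq> 0"
  define r where "r = - form M u w / (form M w w + 1)"
  have p: "form M w w + 1 > 0" using assms(3)[OF w] by simp
  have "u + r *\<^sub>R w \<in> V" using assms by (simp add: subspace_add subspace_scale)
  then have "0 \<le> form M (u + r *\<^sub>R w) (u + r *\<^sub>R w)" by (rule assms(3))
  also have "\<dots> = 2 * r * form M u w + r\<^sup>2 * form M w w"
    using form_commute[OF assms(1), of w u] u
    by (simp add: form_add_left form_add_right form_scale_left form_scale_right power2_eq_square algebra_simps)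
  also have "\<dots> = - (r\<^sup>2 * (form M w w + 2))"
  proof -
    have b: "form M u w = - (r * (form M w w + 1))" using p by (simp add: r_def)
    show ?thesis by (subst b) (simp add: power2_eq_square algebra_simps)
  qed
  also have "\<dots> < 0" using p n by (simp add: r_def)
  finally show False by simp
qed

lemma subspace_eigenspace: "subspace V \<Longrightarrow> subspace (form_space V (form A) (form M) l)"
  unfolding subspace_def form_space_def
  by (auto simp: form_add_left form_scale_left algebra_simps)

lemma subspace_Ker: "subspace (Ker C)"
  unfolding subspace_def Ker_def
  by (auto simp: matrix_vector_right_distrib matrix_vector_mult_scaleR)

lemma pos_semidef_null:
  assumes "transpose C = C" "pos_semidef C" "form C u u = 0"
  shows "u \<in> Ker C"
proof -
  have "form C (C *v u) u = 0"
    using form_null_of_semidefinite[of C UNIV u "C *v u"] assms form_commute[OF assms(1)]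
    by (simp add: pos_semidef_def form_def)
  then show ?thesis by (simp add: form_def Ker_def)
qed

lemma eigenbasis_exists:
  fixes A M :: "real^'n^'n"
  assumes A: "transpose A = A" "pos_def A" and M: "transpose M = M" and V: "subspace V"
  shows "\<exists>S \<mu>. finite S \<and> S \<subseteq> V - {0} \<and> V \<subseteq> span S \<and>
    (\<forall>v\<in>S. \<forall>w\<in>S. v \<noteq> w \<longrightarrow> form A v w = 0) \<and>
    (\<forall>v\<in>S. \<forall>w\<in>V. form M v w = \<mu> v * form A v w)"
  using V
proof (induction "dim V" arbitrary: V rule: less_induct)
  case less
  note V = \<open>subspace V\<close>
  show ?case
  proof (cases "V \<subseteq> {0}")
    case True
    then show ?thesis by (intro exI[of _ "{}"]) auto
  next
    case False
    then obtain z where z: "z \<in> V" "z \<noteq> 0" by auto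
    let ?K = "V \<inter> sphere 0 1"
    have "(1 / norm z) *\<^sub>R z \<in> ?K" using z V by (auto simp: subspace_scale)
    moreover have "compact ?K" using closed_subspace[OF V] by (simp add: closed_Int_compact)
    moreover have "form A u u \<noteq> 0" if "u \<in> ?K" for u
      using pos_def_form[OF A(2), of u] that by fastforce
    then have "continuous_on ?K (\<lambda>u. form M u u / form A u u)"
      by (intro continuous_on_divide continuous_on_form) blast
    ultimately obtain e where e: "e \<in> ?K"
      "\<And>u. u \<in> ?K \<Longrightarrow> form M u u / form A u u \<le> form M e e / form A e e"
      using continuous_attains_sup[of ?K "\<lambda>u. form M u u / form A u u"] by blast
    have eV: "e \<in> V" "e \<noteq> 0" using e(1) by auto
    have eA: "form A e e > 0" by (rule pos_def_form[OF A(2) eV(2)])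
    \<comment> \<open>A maximiser of the Rayleigh quotient is an eigenvector: \<open>m A - M\<close> is semidefinite and null there.\<close>
    define m where "m = form M e e / form A e e"
    let ?Q = "m *\<^sub>R A - M"
    have sQ: "transpose ?Q = ?Q" using A M by (simp add: transpose_def vec_eq_iff)
    have Q0: "0 \<le> form ?Q u u" if u: "u \<in> V" for u
    proof (cases "u = 0")
      case False
      let ?u = "(1 / norm u) *\<^sub>R u"
      have "form M ?u ?u / form A ?u ?u \<le> m" unfolding m_def
        by (rule e(2)) (use u V False in \<open>auto simp: subspace_scale\<close>)
      moreover have "form M ?u ?u / form A ?u ?u = form M u u / form A u u"
        using False by (simp add: form_scale_left form_scale_right)
      ultimately show ?thesis using pos_def_form[OF A(2) False]
        by (simp add: form_matrix_simps field_simps)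
    qed simp
    have "form ?Q e e = 0" using eA by (simp add: form_matrix_simps m_def)
    then have eM: "form M e w = m * form A e w" if "w \<in> V" for w
      using form_null_of_semidefinite[OF sQ V Q0 eV(1) _ that] by (simp add: form_matrix_simps)
    define V' where "V' = {w \<in> V. form A e w = 0}"
    have V': "subspace V'" "V' \<subseteq> V" using V unfolding V'_def subspace_def
      by (auto simp: form_add_right form_scale_right)
    have "e \<notin> V'" using eA by (simp add: V'_def)
    then have "V' \<noteq> V" using eV by blast
    then have "V' \<subset> V" using V' by auto
    then have "dim V' < dim V" using V V'(1)
      by (metis dim_psubset span_eq_iff)
    from less.hyps[OF this V'(1)] obtain S \<mu> where S: "finite S" "S \<subseteq> V' - {0}" "V' \<subseteq> span S"
      "\<forall>v\<in>S. \<forall>w\<in>S. v \<noteq> w \<longrightarrow> form A v w = 0"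
      "\<forall>v\<in>S. \<forall>w\<in>V'. form M v w = \<mu> v * form A v w" by blast
    have decomp: "w - (form A e w / form A e e) *\<^sub>R e \<in> V'" if "w \<in> V" for w
    proof -
      have "form A e (w + (- (form A e w / form A e e)) *\<^sub>R e) = 0"
        unfolding form_add_right form_scale_right using eA by simp
      then show ?thesis using that eV(1) V unfolding V'_def
        by (simp add: subspace_diff subspace_scale)
    qed
    have S0: "form A e v = 0" "form A v e = 0" "form M v e = 0" if "v \<in> S" for v
      using that S(2) eM[of v] form_commute[OF A(1), of v e] form_commute[OF M, of v e]
      by (auto simp: V'_def)
    define \<nu> where "\<nu> = \<mu>(e := m)"
    have eS: "e \<notin> S" using \<open>e \<notin> V'\<close> S(2) by auto
    have "V \<subseteq> span (insert e S)"
    proof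
      fix w assume "w \<in> V"
      then have "w - (form A e w / form A e e) *\<^sub>R e \<in> span S" using decomp S(3) by blast
      then show "w \<in> span (insert e S)" unfolding span_breakdown_eq by blast
    qed
    moreover have "form M v w = \<nu> v * form A v w" if v: "v \<in> insert e S" and w: "w \<in> V" for v w
    proof (cases "v = e")
      case True then show ?thesis using eM w by (simp add: \<nu>_def)
    next
      case False
      then have vS: "v \<in> S" using v by simp
      define w' where "w' = w - (form A e w / form A e e) *\<^sub>R e"
      have w': "w' \<in> V'" using decomp[OF w] by (simp add: w'_def)
      have "w = w' + (form A e w / form A e e) *\<^sub>R e" by (simp add: w'_def)
      then obtain r where "w = w' + r *\<^sub>R e" by blast
      then show ?thesis using S(5) vS w' False S0[OF vS]
        by (simp add: form_add_right form_scale_right \<nu>_def)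
    qed
    moreover have "insert e S \<subseteq> V - {0}" using S(2) V'(2) eV by auto
    moreover have "\<forall>v\<in>insert e S. \<forall>w\<in>insert e S. v \<noteq> w \<longrightarrow> form A v w = 0" using S(4) S0 by auto
    ultimately show ?thesis using S(1) by (intro exI[of _ "insert e S"] exI[of _ \<nu>]) auto
  qed
qed

text \<open>The number of positive eigenvalues \<open>l\<close> with \<open>1 / l > s\<close>, also meaningful at \<open>s = 0\<close>.\<close>

definition count_pos :: "(real \<Rightarrow> (real^'n) set) \<Rightarrow> real \<Rightarrow> nat" where
  "count_pos E s = length (filter (\<lambda>l. s * l < 1) (pos_list E))"

lemma length_filter_concat_replicate:
  "length (filter p (concat (map (\<lambda>x. replicate (f x) x) xs))) =
    sum_list (map (\<lambda>x. if p x then f x else 0) xs)"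
  by (induction xs) (auto simp: filter_replicate)

lemma eigenvalue_count_split:
  fixes A M :: "real^'n^'n" and s :: real
  assumes A: "transpose A = A" "pos_def A" and M: "transpose M = M" and V: "subspace V" and s: "0 \<le> s"
  defines "N \<equiv> count_pos (form_space V (form A) (form M)) s"
  obtains X Y where "subspace X" "X \<subseteq> V" "dim X = N"
    "\<And>u. u \<in> X \<Longrightarrow> u \<noteq> 0 \<Longrightarrow> s * form A u u < form M u u"
    "subspace Y" "Y \<subseteq> V" "dim Y + N = dim V"
    "\<And>u. u \<in> Y \<Longrightarrow> form M u u \<le> s * form A u u"
    "\<And>u v. u \<in> Y \<Longrightarrow> form M u u = s * form A u u \<Longrightarrow> v \<in> V \<Longrightarrow> form M u v = s * form A u v"
proof -
  obtain S \<mu> where S: "finite S" "S \<subseteq> V - {0}" "V \<subseteq> span S"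
    and ort: "\<And>v w. v \<in> S \<Longrightarrow> w \<in> S \<Longrightarrow> v \<noteq> w \<Longrightarrow> form A v w = 0"
    and eig: "\<And>v w. v \<in> S \<Longrightarrow> w \<in> V \<Longrightarrow> form M v w = \<mu> v * form A v w"
    using eigenbasis_exists[OF A M V] by metis
  have spanS: "span S = V" using S V by (simp add: span_minimal subset_antisym subset_Diff_insert)
  have posA: "form A v v > 0" if "v \<in> S" for v
    using that S(2) by (intro pos_def_form[OF A(2)]) auto
  have comb_A: "form A (\<Sum>v\<in>T. c v *\<^sub>R v) w = (if w \<in> T then c w * form A w w else 0)"
    if "T \<subseteq> S" "w \<in> S" for T c w
  proof -
    have "form A (\<Sum>v\<in>T. c v *\<^sub>R v) w = (\<Sum>v\<in>T. if v = w then c w * form A w w else 0)"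
      unfolding form_sum_left form_scale_left using that ort by (intro sum.cong) auto
    then show ?thesis using finite_subset[OF that(1) S(1)] by simp
  qed
  have comb_M: "form M (\<Sum>v\<in>T. c v *\<^sub>R v) w = (\<Sum>v\<in>T. c v * \<mu> v * form A v w)"
    if "T \<subseteq> S" "w \<in> V" for T c w
    unfolding form_sum_left form_scale_left using that eig by (intro sum.cong) auto
  have comb_AA: "form A (\<Sum>v\<in>T. c v *\<^sub>R v) (\<Sum>v\<in>T. c v *\<^sub>R v) = (\<Sum>v\<in>T. (c v)\<^sup>2 * form A v v)"
    if "T \<subseteq> S" for T c
    unfolding form_sum_left[where S = T] form_scale_left
  proof (rule sum.cong)
    fix v assume "v \<in> T"
    have "form A v (\<Sum>v\<in>T. c v *\<^sub>R v) = form A (\<Sum>v\<in>T. c v *\<^sub>R v) v"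
      by (rule form_commute[OF A(1)])
    also have "\<dots> = c v * form A v v"
      using comb_A[OF that, of v c] that \<open>v \<in> T\<close> by auto
    finally show "c v * form A v (\<Sum>v\<in>T. c v *\<^sub>R v) = (c v)\<^sup>2 * form A v v"
      by (simp add: power2_eq_square)
  qed simp
  have span_in_V: "(\<Sum>v\<in>T. c v *\<^sub>R v) \<in> V" if "T \<subseteq> S" for T c
    using that V S(2) by (intro subspace_sum subspace_scale) auto
  have comb_MM: "form M (\<Sum>v\<in>T. c v *\<^sub>R v) (\<Sum>v\<in>T. c v *\<^sub>R v) = (\<Sum>v\<in>T. (c v)\<^sup>2 * \<mu> v * form A v v)"
    if "T \<subseteq> S" for T c
    unfolding comb_M[OF that span_in_V[OF that]]
  proof (rule sum.cong)
    fix v assume "v \<in> T"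
    have "form A v (\<Sum>v\<in>T. c v *\<^sub>R v) = form A (\<Sum>v\<in>T. c v *\<^sub>R v) v"
      by (rule form_commute[OF A(1)])
    also have "\<dots> = c v * form A v v"
      using comb_A[OF that, of v c] that \<open>v \<in> T\<close> by auto
    finally show "c v * \<mu> v * form A v (\<Sum>v\<in>T. c v *\<^sub>R v) = (c v)\<^sup>2 * \<mu> v * form A v v"
      by (simp add: power2_eq_square)
  qed simp
  have span_comb: "\<exists>c. u = (\<Sum>v\<in>T. c v *\<^sub>R v)" if "T \<subseteq> S" "u \<in> span T" for T u
    using that finite_subset[OF that(1) S(1)] by (auto simp: span_finite)
  have indep: "independent S"
  proof (rule ccontr)
    assume "\<not> independent S"
    then obtain c w where "(\<Sum>v\<in>S. c v *\<^sub>R v) = 0" "w \<in> S" "c w \<noteq> 0"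
      using S(1) dependent_finite by blast
    then show False using comb_A[of S w c] posA[of w] by simp
  qed
  have dim_span_sub: "dim (span T) = card T" if "T \<subseteq> S" for T
    using independent_mono[OF indep that] by (simp add: dim_eq_card_independent)

  let ?E = "form_space V (form A) (form M)"
  have E: "?E l = span {v\<in>S. l * \<mu> v = 1}" for l
  proof
    show "span {v\<in>S. l * \<mu> v = 1} \<subseteq> ?E l"
    proof (rule span_minimal)
      show "{v \<in> S. l * \<mu> v = 1} \<subseteq> ?E l"
        using S(2) eig by (auto simp: form_space_def mult.assoc[symmetric])
    qed (rule subspace_eigenspace[OF V])
    show "?E l \<subseteq> span {v\<in>S. l * \<mu> v = 1}"
    proof
      fix u assume u: "u \<in> ?E l"
      then obtain c where c: "u = (\<Sum>v\<in>S. c v *\<^sub>R v)"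
        using span_comb[of S u] spanS by (auto simp: form_space_def)
      have "c w = 0 \<or> l * \<mu> w = 1" if w: "w \<in> S" for w
      proof -
        have wV: "w \<in> V" using w S(2) by auto
        have "form M u w = (\<Sum>v\<in>S. (c v * \<mu> v) * form A v w)" using comb_M[of S w c] c wV by simp
        also have "\<dots> = c w * \<mu> w * form A w w"
          using comb_A[of S w "\<lambda>v. c v * \<mu> v"] w by (simp add: form_sum_left form_scale_left)
        finally have "form M u w = c w * \<mu> w * form A w w" .
        moreover have "form A u w = c w * form A w w" using comb_A[of S w c] c w by simp
        moreover have "form A u w = l * form M u w" using u wV by (auto simp: form_space_def)
        ultimately show ?thesis using posA[OF w] by (auto simp: algebra_simps)
      qed
      then have u_sum: "u = (\<Sum>v\<in>{v\<in>S. l * \<mu> v = 1}. c v *\<^sub>R v)"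
        unfolding c using S(1) by (intro sum.mono_neutral_right) auto
      show "u \<in> span {v\<in>S. l * \<mu> v = 1}"
        unfolding u_sum by (intro span_sum span_scale span_base)
    qed
  qed
  have dimE: "dim (?E l) = card {v\<in>S. l * \<mu> v = 1}" for l
    unfolding E by (rule dim_span_sub) auto
  have eigs: "eigenvalues ?E = {l. \<exists>v\<in>S. l * \<mu> v = 1}"
  proof -
    have "(\<exists>u\<in>?E l. u \<noteq> 0) \<longleftrightarrow> (\<exists>v\<in>S. l * \<mu> v = 1)" for l
    proof
      assume "\<exists>u\<in>?E l. u \<noteq> 0"
      then have "dim (?E l) \<noteq> 0" unfolding dim_eq_0 by blast
      then have "{v\<in>S. l * \<mu> v = 1} \<noteq> {}" unfolding dimE by (metis card.empty)
      then show "\<exists>v\<in>S. l * \<mu> v = 1" by blast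
    next
      assume "\<exists>v\<in>S. l * \<mu> v = 1"
      then obtain v where v: "v \<in> S" "l * \<mu> v = 1" by blast
      then have "v \<in> ?E l" unfolding E by (intro span_base) simp
      moreover have "v \<noteq> 0" using v S(2) by blast
      ultimately show "\<exists>u\<in>?E l. u \<noteq> 0" by blast
    qed
    then show ?thesis by (simp add: eigenvalues_def)
  qed
  let ?\<Lambda> = "{l \<in> eigenvalues ?E. 0 < l}"
  have "?\<Lambda> \<subseteq> (\<lambda>v. 1 / \<mu> v) ` S"
  proof
    fix l assume "l \<in> ?\<Lambda>"
    then obtain v where "v \<in> S" "l * \<mu> v = 1" unfolding eigs by blast
    then show "l \<in> (\<lambda>v. 1 / \<mu> v) ` S"
      by (intro image_eqI[of _ _ v]) (auto simp: eq_divide_eq)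
  qed
  then have fin: "finite ?\<Lambda>" using S(1) finite_surj by blast
  have "N = (\<Sum>l\<in>?\<Lambda>. if s * l < 1 then card {v\<in>S. l * \<mu> v = 1} else 0)"
  proof -
    have "N = sum_list (map (\<lambda>l. if s * l < 1 then card {v\<in>S. l * \<mu> v = 1} else 0) (sorted_list_of_set ?\<Lambda>))"
      unfolding N_def count_pos_def pos_list_def dimE by (rule length_filter_concat_replicate)
    then show ?thesis using fin by (simp add: sum_list_distinct_conv_sum_set)
  qed
  also have "\<dots> = (\<Sum>l\<in>{l\<in>?\<Lambda>. s * l < 1}. card {v\<in>S. l * \<mu> v = 1})"
    by (rule sum.inter_filter[OF fin, symmetric])
  also have "\<dots> = card (\<Union>l\<in>{l\<in>?\<Lambda>. s * l < 1}. {v\<in>S. l * \<mu> v = 1})"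
  proof (rule card_UN_disjoint[symmetric])
    show "finite {l\<in>?\<Lambda>. s * l < 1}" using fin by (rule rev_finite_subset) blast
    show "\<forall>l\<in>{l\<in>?\<Lambda>. s * l < 1}. \<forall>l'\<in>{l\<in>?\<Lambda>. s * l < 1}. l \<noteq> l' \<longrightarrow>
        {v\<in>S. l * \<mu> v = 1} \<inter> {v\<in>S. l' * \<mu> v = 1} = {}"
    proof (intro ballI impI, rule ccontr)
      fix l l' assume "l \<noteq> l'" "{v\<in>S. l * \<mu> v = 1} \<inter> {v\<in>S. l' * \<mu> v = 1} \<noteq> {}"
      then obtain v where "l * \<mu> v = 1" "l' * \<mu> v = 1" "l \<noteq> l'" by blast
      then show False by (metis mult_cancel_right mult_zero_right zero_neq_one)
    qed
  qed (simp_all add: fin S(1))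
  also have "(\<Union>l\<in>{l\<in>?\<Lambda>. s * l < 1}. {v\<in>S. l * \<mu> v = 1}) = {v\<in>S. s < \<mu> v}"
  proof (intro equalityI subsetI)
    fix v assume "v \<in> (\<Union>l\<in>{l\<in>?\<Lambda>. s * l < 1}. {v\<in>S. l * \<mu> v = 1})"
    then obtain l where l: "0 < l" "s * l < 1" "v \<in> S" "l * \<mu> v = 1" by auto
    have "l * s < l * \<mu> v" using l by (simp add: mult.commute[of l s])
    then have "s < \<mu> v" using l(1) by (simp only: mult_less_cancel_left_pos)
    then show "v \<in> {v\<in>S. s < \<mu> v}" using l by simp
  next
    fix v assume "v \<in> {v\<in>S. s < \<mu> v}"
    then have v: "v \<in> S" "s < \<mu> v" "0 < \<mu> v" using s by auto
    then have "1 / \<mu> v \<in> {l\<in>?\<Lambda>. s * l < 1}" unfolding eigs by auto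
    then show "v \<in> (\<Union>l\<in>{l\<in>?\<Lambda>. s * l < 1}. {v\<in>S. l * \<mu> v = 1})" using v by (intro UN_I) auto
  qed
  finally have N: "N = card {v\<in>S. s < \<mu> v}" .

  let ?P = "{v\<in>S. s < \<mu> v}" and ?R = "{v\<in>S. \<mu> v \<le> s}"
  have sub: "?P \<subseteq> S" "?R \<subseteq> S" by auto
  show thesis
  proof (rule that[of "span ?P" "span ?R"])
    show "span ?P \<subseteq> V" "span ?R \<subseteq> V"
      using span_mono[OF sub(1)] span_mono[OF sub(2)] spanS by auto
    show "dim (span ?P) = N" using dim_span_sub[OF sub(1)] N by simp
    have "card S = card ?R + card ?P"
    proof -
      have "S = ?R \<union> ?P" by auto
      moreover have "card (?R \<union> ?P) = card ?R + card ?P" using S(1) by (intro card_Un_disjoint) auto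
      ultimately show ?thesis by simp
    qed
    then show "dim (span ?R) + N = dim V"
      using dim_span_sub[OF sub(2)] dim_span_sub[of S] N spanS by simp
    show "s * form A u u < form M u u" if u: "u \<in> span ?P" "u \<noteq> 0" for u
    proof -
      obtain c where c: "u = (\<Sum>v\<in>?P. c v *\<^sub>R v)" using span_comb[OF sub(1) u(1)] by blast
      have "\<exists>w\<in>?P. c w \<noteq> 0"
      proof (rule ccontr)
        assume "\<not> ?thesis"
        then have "u = 0" unfolding c by (intro sum.neutral) simp
        then show False using u(2) by simp
      qed
      then obtain w where w: "w \<in> ?P" "c w \<noteq> 0" by blast
      show ?thesis unfolding c comb_AA[OF sub(1)] comb_MM[OF sub(1)] sum_distrib_left
      proof (rule sum_strict_mono_ex1)
        show "finite ?P" using S(1) by simp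
        show "\<forall>v\<in>?P. s * ((c v)\<^sup>2 * form A v v) \<le> (c v)\<^sup>2 * \<mu> v * form A v v"
        proof
          fix v assume "v \<in> ?P"
          then have "s * ((c v)\<^sup>2 * form A v v) \<le> \<mu> v * ((c v)\<^sup>2 * form A v v)"
            using posA[of v] by (intro mult_right_mono) auto
          then show "s * ((c v)\<^sup>2 * form A v v) \<le> (c v)\<^sup>2 * \<mu> v * form A v v" by (simp add: mult_ac)
        qed
        have "s * ((c w)\<^sup>2 * form A w w) < \<mu> w * ((c w)\<^sup>2 * form A w w)"
          using w posA[of w] by (intro mult_strict_right_mono) auto
        then show "\<exists>a\<in>?P. s * ((c a)\<^sup>2 * form A a a) < (c a)\<^sup>2 * \<mu> a * form A a a"
          using w by (intro bexI[of _ w]) (auto simp: mult_ac)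
      qed
    qed
    have R: "s * ((c v)\<^sup>2 * form A v v) - (c v)\<^sup>2 * \<mu> v * form A v v \<ge> 0" if "v \<in> ?R" for c v
    proof -
      have "\<mu> v * ((c v)\<^sup>2 * form A v v) \<le> s * ((c v)\<^sup>2 * form A v v)"
        using that posA[of v] by (intro mult_right_mono) auto
      then show ?thesis by (simp add: mult_ac)
    qed
    show "form M u u \<le> s * form A u u" if u: "u \<in> span ?R" for u
    proof -
      obtain c where c: "u = (\<Sum>v\<in>?R. c v *\<^sub>R v)" using span_comb[OF sub(2) u(1)] by blast
      show ?thesis unfolding c comb_AA[OF sub(2)] comb_MM[OF sub(2)] sum_distrib_left
        using R by (intro sum_mono) (simp only: diff_ge_0_iff_ge)
    qed
    show "form M u v = s * form A u v" if u: "u \<in> span ?R" "form M u u = s * form A u u" "v \<in> V" for u v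
    proof -
      obtain c where c: "u = (\<Sum>v\<in>?R. c v *\<^sub>R v)" using span_comb[OF sub(2) u(1)] by blast
      have "(\<Sum>v\<in>?R. s * ((c v)\<^sup>2 * form A v v) - (c v)\<^sup>2 * \<mu> v * form A v v) = 0"
        using u(2) unfolding c comb_AA[OF sub(2)] comb_MM[OF sub(2)] sum_subtractf sum_distrib_left by simp
      then have z: "\<forall>v\<in>?R. s * ((c v)\<^sup>2 * form A v v) - (c v)\<^sup>2 * \<mu> v * form A v v = 0"
        by (rule iffD1[OF sum_nonneg_eq_0_iff, rotated 2]) (use R S(1) in simp_all)
      have R0: "c v = 0 \<or> \<mu> v = s" if "v \<in> ?R" for v
      proof -
        have "(s - \<mu> v) * ((c v)\<^sup>2 * form A v v) = 0"
          using that z by (simp add: algebra_simps)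
        then show ?thesis using that posA[of v] by auto
      qed
      have "form M u v = (\<Sum>w\<in>?R. c w * \<mu> w * form A w v)"
        unfolding c by (rule comb_M[OF sub(2) u(3)])
      also have "\<dots> = (\<Sum>w\<in>?R. s * (c w * form A w v))"
      proof (rule sum.cong)
        fix w assume "w \<in> ?R"
        then show "c w * \<mu> w * form A w v = s * (c w * form A w v)" using R0[of w] by auto
      qed simp
      also have "\<dots> = s * form A u v"
        unfolding c form_sum_left form_scale_left sum_distrib_left ..
      finally show ?thesis .
    qed
  qed (auto simp: subspace_span)
qed

lemma sorted_filter_less_length:
  fixes xs :: "'a::linorder list"
  assumes "sorted xs" "1 \<le> j"
  shows "j \<le> length (filter (\<lambda>l. l < x) xs) \<longleftrightarrow> j \<le> length xs \<and> xs ! (j - 1) < x"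
  using assms
proof (induction xs arbitrary: j)
  case (Cons a xs)
  show ?case
  proof (cases "a < x")
    case True
    show ?thesis
    proof (cases "j = 1")
      case False
      then obtain i where i: "j = Suc i" "1 \<le> i" using Cons.prems(2) by (cases j) auto
      then show ?thesis using Cons.IH[of i] Cons.prems(1) True by (simp add: nth_Cons')
    qed (use True in simp)
  next
    case False
    then have "filter (\<lambda>l. l < x) (a # xs) = []"
      using Cons.prems(1) by (auto simp: filter_empty_conv)
    moreover have "\<not> (a # xs) ! (j - 1) < x" if "j \<le> length (a # xs)"
    proof -
      have "a \<le> (a # xs) ! (j - 1)"
        using sorted_nth_mono[OF Cons.prems(1), of 0 "j - 1"] that Cons.prems(2) by simp
      then show ?thesis using False by simp
    qed
    ultimately show ?thesis using Cons.prems(2) by auto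
  qed
qed simp

lemma sorted_pos_list: "sorted (pos_list E)"
proof -
  have "sorted (concat (map (\<lambda>l. replicate (f l) l) xs))" if "sorted xs" for f :: "real \<Rightarrow> nat" and xs
    using that by (induction xs) (auto simp: sorted_append)
  then show ?thesis by (simp add: pos_list_def)
qed

lemma count_pos_0: "count_pos E 0 = num_pos E"
  by (simp add: count_pos_def num_pos_def)

lemma pos_eig_less_iff:
  assumes "0 < x" "1 \<le> j"
  shows "j \<le> count_pos E (1 / x) \<longleftrightarrow> j \<le> num_pos E \<and> pos_eig E j < x"
  using sorted_filter_less_length[OF sorted_pos_list[of E] assms(2), of x] assms(1)
  by (simp add: count_pos_def num_pos_def pos_eig_def)

lemma pos_eig_gt_0:
  assumes "1 \<le> j" "j \<le> num_pos E"
  shows "0 < pos_eig E j"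
proof -
  have "pos_eig E j \<in> set (pos_list E)" using assms by (simp add: pos_eig_def num_pos_def)
  moreover have "set (pos_list E) \<subseteq> {l. 0 < l}"
    by (cases "finite {l \<in> eigenvalues E. 0 < l}") (auto simp: pos_list_def)
  ultimately show ?thesis by auto
qed

lemma sorted_list_of_set_uminus:
  fixes S :: "real set"
  shows "rev (sorted_list_of_set (uminus ` S)) = map uminus (sorted_list_of_set S)"
proof (cases "finite S")
  case True
  have "sorted (rev (map uminus (sorted_list_of_set S)))"
    by (simp add: sorted_wrt_rev sorted_wrt_map)
  then have "sorted_list_of_set (uminus ` S) = rev (map uminus (sorted_list_of_set S))"
    using True by (intro sorted_distinct_set_unique) (auto simp: distinct_map)
  then show ?thesis by simp
next
  case False
  moreover from this have "infinite (uminus ` S)" by (simp add: finite_image_iff)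
  ultimately show ?thesis by simp
qed

lemma neg_list_uminus: "neg_list E = map uminus (pos_list (\<lambda>l. E (- l)))"
proof -
  have "{l \<in> eigenvalues E. l < 0} = uminus ` {l \<in> eigenvalues (\<lambda>l. E (- l)). 0 < l}"
  proof (intro equalityI subsetI)
    fix l assume "l \<in> {l \<in> eigenvalues E. l < 0}"
    then show "l \<in> uminus ` {l \<in> eigenvalues (\<lambda>l. E (- l)). 0 < l}"
      by (intro image_eqI[of _ _ "- l"]) (simp_all add: eigenvalues_def)
  qed (auto simp: eigenvalues_def)
  then show ?thesis
    by (simp add: neg_list_def pos_list_def sorted_list_of_set_uminus map_concat o_def)
qed

lemma num_neg_uminus: "num_neg E = num_pos (\<lambda>l. E (- l))"
  by (simp add: num_neg_def num_pos_def neg_list_uminus)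

lemma neg_eig_uminus:
  "1 \<le> j \<Longrightarrow> j \<le> num_neg E \<Longrightarrow> neg_eig E j = - pos_eig (\<lambda>l. E (- l)) j"
  by (simp add: num_neg_def neg_eig_def pos_eig_def neg_list_uminus)

lemma pos_eig_tendsto:
  assumes i: "1 \<le> i" and j: "1 \<le> j" "j \<le> num_pos L"
    and low: "\<And>s. 0 \<le> s \<Longrightarrow> j \<le> count_pos L s \<Longrightarrow> \<forall>\<^sub>F t in F. i \<le> count_pos (E t) s"
    and up: "\<And>s s'. 0 \<le> s' \<Longrightarrow> s' < s \<Longrightarrow> count_pos L s' < j \<Longrightarrow> \<forall>\<^sub>F t in F. count_pos (E t) s < i"
  shows "(\<forall>\<^sub>F t in F. i \<le> num_pos (E t)) \<and> ((\<lambda>t. pos_eig (E t) i) \<longlongrightarrow> pos_eig L j) F"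
proof
  show ex: "\<forall>\<^sub>F t in F. i \<le> num_pos (E t)"
    using low[of 0] j by (simp add: count_pos_0)
  show "((\<lambda>t. pos_eig (E t) i) \<longlongrightarrow> pos_eig L j) F"
  proof (rule order_tendstoI)
    fix x assume x: "pos_eig L j < x"
    then have "0 < x" using pos_eig_gt_0[OF j] by simp
    with x j have "j \<le> count_pos L (1 / x)" by (simp add: pos_eig_less_iff)
    then have "\<forall>\<^sub>F t in F. i \<le> count_pos (E t) (1 / x)" using low \<open>0 < x\<close> by simp
    then show "\<forall>\<^sub>F t in F. pos_eig (E t) i < x"
      by eventually_elim (use \<open>0 < x\<close> i in \<open>simp add: pos_eig_less_iff\<close>)
  next
    fix x assume x: "x < pos_eig L j"
    show "\<forall>\<^sub>F t in F. x < pos_eig (E t) i"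
    proof (cases "0 < x")
      case False
      show ?thesis using ex by eventually_elim (use False pos_eig_gt_0[OF i] in force)
    next
      case True
      obtain y where y: "x < y" "y < pos_eig L j" using x dense by blast
      obtain z where z: "y < z" "z < pos_eig L j" using y dense by blast
      have "\<not> j \<le> count_pos L (1 / z)" using pos_eig_less_iff[of z j L] j z y True by simp
      then have "\<forall>\<^sub>F t in F. count_pos (E t) (1 / y) < i"
        using up[of "1 / z" "1 / y"] z y True by (simp add: frac_less2)
      with ex show ?thesis
        by eventually_elim (use y True i in \<open>metis linorder_not_le order.strict_trans2 pos_eig_less_iff[of y i] order.strict_trans\<close>)
    qed
  qed
qed

lemma pos_eig_tendsto_0:
  assumes i: "1 \<le> i" and low: "\<And>s. 0 \<le> s \<Longrightarrow> \<forall>\<^sub>F t in F. i \<le> count_pos (E t) s"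
  shows "(\<forall>\<^sub>F t in F. i \<le> num_pos (E t)) \<and> ((\<lambda>t. pos_eig (E t) i) \<longlongrightarrow> 0) F"
proof
  show ex: "\<forall>\<^sub>F t in F. i \<le> num_pos (E t)"
    using low[of 0] by (simp add: count_pos_0)
  show "((\<lambda>t. pos_eig (E t) i) \<longlongrightarrow> 0) F"
  proof (rule order_tendstoI)
    fix x :: real assume "0 < x"
    then have "\<forall>\<^sub>F t in F. i \<le> count_pos (E t) (1 / x)" using low by simp
    then show "\<forall>\<^sub>F t in F. pos_eig (E t) i < x"
      by eventually_elim (use \<open>0 < x\<close> i in \<open>simp add: pos_eig_less_iff\<close>)
  next
    fix x :: real assume "x < 0"
    show "\<forall>\<^sub>F t in F. x < pos_eig (E t) i"
      using ex by eventually_elim (use \<open>x < 0\<close> pos_eig_gt_0[OF i] in force)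
  qed
qed

lemma pos_eig_at_top:
  assumes i: "1 \<le> i" and ex: "\<forall>\<^sub>F t in F. i \<le> num_pos (E t)"
    and up: "\<And>s. 0 < s \<Longrightarrow> \<forall>\<^sub>F t in F. count_pos (E t) s < i"
  shows "filterlim (\<lambda>t. pos_eig (E t) i) at_top F"
  unfolding filterlim_at_top_gt[where c = 0]
proof (intro allI impI)
  fix x :: real assume "0 < x"
  then have "\<forall>\<^sub>F t in F. count_pos (E t) (1 / x) < i" using up by simp
  with ex show "\<forall>\<^sub>F t in F. x \<le> pos_eig (E t) i"
    by eventually_elim (use \<open>0 < x\<close> i in \<open>metis linorder_not_le pos_eig_less_iff[of x i]\<close>)
qed

lemma dim_add_le_of_trivial_Int:
  fixes X Y V :: "'a::euclidean_space set"
  assumes "subspace X" "subspace Y" "X \<subseteq> V" "Y \<subseteq> V" "subspace V" "\<And>u. u \<in> X \<Longrightarrow> u \<in> Y \<Longrightarrow> u = 0"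
  shows "dim X + dim Y \<le> dim V"
proof -
  have "X \<inter> Y \<subseteq> {0}" using assms(6) by blast
  then have "dim (X \<inter> Y) = 0" by (simp only: dim_eq_0)
  moreover have "dim {x + y |x y. x \<in> X \<and> y \<in> Y} \<le> dim V"
    using assms(3,4) by (intro dim_subset) (auto intro!: subspace_add[OF assms(5)])
  ultimately show ?thesis using dim_sums_Int[OF assms(1,2)] by linarith
qed

lemma dim_Ker:
  fixes C :: "real^'n^'n"
  assumes "transpose C = C"
  shows "dim (Ker C) + rank C = CARD('n)"
proof -
  have "{y \<in> UNIV. \<forall>x\<in>range ((*v) C). orthogonal x y} = Ker C"
  proof -
    have "(\<forall>x. (C *v x) \<bullet> y = 0) \<longleftrightarrow> C *v y = 0" for y
    proof -
      have "(C *v x) \<bullet> y = x \<bullet> (C *v y)" for x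
        using form_commute[OF assms, of y x] by (simp add: form_def inner_commute)
      then show ?thesis by (metis inner_eq_zero_iff inner_zero_right)
    qed
    then show ?thesis by (auto simp: Ker_def orthogonal_def)
  qed
  then show ?thesis
    using dim_subspace_orthogonal_to_vectors[of "range ((*v) C)" UNIV]
      matrix_vector_mul_linear[of C]
    by (simp add: rank_dim_range linear_subspace_image)
qed

lemma Ker_complement:
  fixes C :: "real^'n^'n"
  assumes C: "transpose C = C" and Y: "subspace Y" "Y \<subseteq> Ker C"
  obtains U where "subspace U" "dim U = dim Y + rank C" "U \<inter> Ker C \<subseteq> Y"
proof -
  define Z where "Z = {y \<in> UNIV. \<forall>x\<in>Ker C. orthogonal x y}"
  have Z: "subspace Z" unfolding Z_def by (simp add: subspace_orthogonal_to_vectors)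
  have "dim Z + dim (Ker C) = CARD('n)"
    using dim_subspace_orthogonal_to_vectors[OF subspace_Ker[of C] subspace_UNIV subset_UNIV]
    by (simp add: Z_def)
  then have dimZ: "dim Z = rank C" using dim_Ker[OF C] by simp
  have ZK: "u = 0" if "u \<in> Z" "u \<in> Ker C" for u
    using that by (auto simp: Z_def orthogonal_def)
  let ?U = "{x + y |x y. x \<in> Y \<and> y \<in> Z}"
  show thesis
  proof (rule that[of ?U])
    show "subspace ?U" using Y(1) Z by (rule subspace_sums)
    have "Y \<inter> Z \<subseteq> {0}" using ZK Y(2) by blast
    then have "dim (Y \<inter> Z) = 0" by (simp only: dim_eq_0)
    then show "dim ?U = dim Y + rank C" using dim_sums_Int[OF Y(1) Z] dimZ by linarith
    show "?U \<inter> Ker C \<subseteq> Y"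
    proof
      fix u assume "u \<in> ?U \<inter> Ker C"
      then obtain y z where u: "u = y + z" "y \<in> Y" "z \<in> Z" "u \<in> Ker C" by blast
      then have "u - y \<in> Ker C" using Y(2) subspace_Ker by (blast intro: subspace_diff)
      then have "z = 0" using u ZK by simp
      then show "u \<in> Y" using u by simp
    qed
  qed
qed

lemma penalty_dominates:
  fixes C Q :: "real^'n^'n"
  assumes C: "transpose C = C" "pos_semidef C" and U: "subspace U"
    and neg: "\<And>u. u \<in> U \<Longrightarrow> u \<in> Ker C \<Longrightarrow> u \<noteq> 0 \<Longrightarrow> form Q u u < 0"
  shows "\<forall>\<^sub>F t in at_top. \<forall>u\<in>U. u \<noteq> 0 \<longrightarrow> form Q u u < t * form C u u"
proof -
  let ?K = "U \<inter> sphere 0 1 \<inter> {u. 0 \<le> form Q u u}"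
  have C0: "0 \<le> form C u u" for u using C(2) by (simp add: pos_semidef_def form_def)
  have Cpos: "0 < form C u u" if "u \<in> ?K" for u
  proof (rule ccontr)
    assume "\<not> 0 < form C u u"
    then have "u \<in> Ker C" using C0[of u] by (intro pos_semidef_null[OF C]) simp
    then show False using neg[of u] that by fastforce
  qed
  have "closed {u. 0 \<le> form Q u u}" by (intro closed_Collect_le continuous_on_form continuous_intros)
  then have "compact ?K" using closed_subspace[OF U] by (simp add: closed_Int_compact compact_Int_closed)
  moreover have "continuous_on ?K (\<lambda>u. form Q u u / form C u u)"
    using Cpos by (intro continuous_on_divide continuous_on_form) force
  ultimately have "bounded ((\<lambda>u. form Q u u / form C u u) ` ?K)"
    using compact_continuous_image compact_imp_bounded by blast
  then obtain m where m: "\<And>u. u \<in> ?K \<Longrightarrow> form Q u u / form C u u \<le> m"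
    unfolding bounded_real by (fastforce simp: abs_le_iff)
  have "form Q u u < t * form C u u" if t: "t > max m 0" and u: "u \<in> U" "u \<noteq> 0" for t u
  proof -
    let ?u = "(1 / norm u) *\<^sub>R u"
    have "form Q ?u ?u < t * form C ?u ?u"
    proof (cases "?u \<in> ?K")
      case True
      then have "form Q ?u ?u / form C ?u ?u < t" using m[OF True] t by simp
      then show ?thesis using Cpos[OF True] by (simp only: pos_divide_less_eq)
    next
      case False
      then have "form Q ?u ?u < 0" using u U by (auto simp: subspace_scale not_le)
      moreover have "0 \<le> t * form C ?u ?u" using C0 t by (intro mult_nonneg_nonneg) auto
      ultimately show ?thesis by linarith
    qed
    then show ?thesis using u(2) by (simp add: form_scale_left form_scale_right field_simps)
  qed
  then show ?thesis unfolding eventually_at_top_dense by blast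
qed

lemma form_space_uminus:
  "form_space V (form A) (form M) (- l) = form_space V (form A) (form (- M)) l"
  by (simp add: form_space_def form_matrix_minus)

lemma pencil_space_eq_form_space:
  assumes "transpose A = A" "transpose M = M"
  shows "pencil_space A M = form_space UNIV (form A) (form M)"
proof
  fix l
  have "(\<forall>v. form A u v = l * form M u v) \<longleftrightarrow> A *v u = l *\<^sub>R (M *v u)" for u
  proof -
    have "(\<forall>v. form A u v = l * form M u v) \<longleftrightarrow> (\<forall>v. v \<bullet> (A *v u) = v \<bullet> (l *\<^sub>R (M *v u)))"
      using form_commute[OF assms(1), of u] form_commute[OF assms(2), of u] by (simp add: form_def)
    also have "\<dots> \<longleftrightarrow> A *v u = l *\<^sub>R (M *v u)" by (rule vector_eq_ldot)
    finally show ?thesis .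
  qed
  then show "pencil_space A M l = form_space UNIV (form A) (form M) l"
    by (simp add: pencil_space_def form_space_def)
qed

lemma dim_le_count_pos:
  fixes A M :: "real^'n^'n"
  assumes "transpose A = A" "pos_def A" "transpose M = M" "subspace V" "0 \<le> s"
    and X: "subspace X" "X \<subseteq> V" "\<And>u. u \<in> X \<Longrightarrow> u \<noteq> 0 \<Longrightarrow> s * form A u u < form M u u"
  shows "dim X \<le> count_pos (form_space V (form A) (form M)) s"
proof -
  obtain Y where Y: "subspace Y" "Y \<subseteq> V"
    "dim Y + count_pos (form_space V (form A) (form M)) s = dim V"
    "\<And>u. u \<in> Y \<Longrightarrow> form M u u \<le> s * form A u u"
    using eigenvalue_count_split[OF assms(1-5)] by metis
  have "dim X + dim Y \<le> dim V"
    using X(3) Y(4) by (intro dim_add_le_of_trivial_Int X(1,2) Y(1,2) assms(4)) (meson not_le)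
  then show ?thesis using Y(3) by simp
qed

lemma count_pos_le_codim:
  fixes A M :: "real^'n^'n"
  assumes "transpose A = A" "pos_def A" "transpose M = M" "subspace V" "0 \<le> s"
    and Y: "subspace Y" "Y \<subseteq> V" "\<And>u. u \<in> Y \<Longrightarrow> u \<noteq> 0 \<Longrightarrow> form M u u \<le> s * form A u u"
  shows "count_pos (form_space V (form A) (form M)) s + dim Y \<le> dim V"
proof -
  obtain X where X: "subspace X" "X \<subseteq> V"
    "dim X = count_pos (form_space V (form A) (form M)) s"
    "\<And>u. u \<in> X \<Longrightarrow> u \<noteq> 0 \<Longrightarrow> s * form A u u < form M u u"
    using eigenvalue_count_split[OF assms(1-5)] by metis
  have "dim X + dim Y \<le> dim V"
    using Y(3) X(4) by (intro dim_add_le_of_trivial_Int X(1,2) Y(1,2) assms(4)) (meson not_le)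
  then show ?thesis using X(3) by simp
qed

context
  fixes A B C :: "real^'n^'n"
  assumes A: "transpose A = A" "pos_def A" and B: "transpose B = B"
    and C: "transpose C = C" "pos_semidef C"
begin

lemma transpose_penalized: "transpose (B - t *\<^sub>R C) = B - t *\<^sub>R C" "transpose (- (B - t *\<^sub>R C)) = - (B - t *\<^sub>R C)"
  "transpose (- B) = - B"
  using B C by (simp_all add: transpose_def vec_eq_iff)

lemma count_pos_penalized_le:
  assumes "0 \<le> s'" "s' < s"
  shows "\<forall>\<^sub>F t in at_top. count_pos (form_space UNIV (form A) (form (B - t *\<^sub>R C))) s
    \<le> count_pos (form_space (Ker C) (form A) (form B)) s'"
proof -
  obtain Y where Y: "subspace Y" "Y \<subseteq> Ker C"
    "dim Y + count_pos (form_space (Ker C) (form A) (form B)) s' = dim (Ker C)"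
    "\<And>u. u \<in> Y \<Longrightarrow> form B u u \<le> s' * form A u u"
    using eigenvalue_count_split[OF A B subspace_Ker assms(1), of C] by metis
  obtain U where U: "subspace U" "dim U = dim Y + rank C" "U \<inter> Ker C \<subseteq> Y"
    by (rule Ker_complement[OF C(1) Y(1,2)])
  have "form (B - s *\<^sub>R A) u u < 0" if "u \<in> U" "u \<in> Ker C" "u \<noteq> 0" for u
  proof -
    have "form B u u \<le> s' * form A u u" using Y(4) U(3) that by blast
    also have "\<dots> < s * form A u u" using assms(2) pos_def_form[OF A(2) that(3)] by simp
    finally show ?thesis by (simp add: form_matrix_simps)
  qed
  then have "\<forall>\<^sub>F t in at_top. \<forall>u\<in>U. u \<noteq> 0 \<longrightarrow> form (B - s *\<^sub>R A) u u < t * form C u u"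
    by (intro penalty_dominates C U(1))
  then show ?thesis
  proof eventually_elim
    case (elim t)
    have "count_pos (form_space UNIV (form A) (form (B - t *\<^sub>R C))) s + dim U \<le> dim (UNIV :: (real^'n) set)"
      using assms elim
      by (intro count_pos_le_codim[OF A transpose_penalized(1) subspace_UNIV _ U(1)])
        (force simp: form_matrix_simps)+
    then show ?case using U(2) Y(3) dim_Ker[OF C(1)] by simp
  qed
qed

lemma count_neg_penalized_ge:
  assumes "0 \<le> s"
  shows "\<forall>\<^sub>F t in at_top. rank C + count_pos (form_space (Ker C) (form A) (form (- B))) s
    \<le> count_pos (form_space UNIV (form A) (form (- (B - t *\<^sub>R C)))) s"
proof -
  obtain X where X: "subspace X" "X \<subseteq> Ker C"
    "dim X = count_pos (form_space (Ker C) (form A) (form (- B))) s"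
    "\<And>u. u \<in> X \<Longrightarrow> u \<noteq> 0 \<Longrightarrow> s * form A u u < form (- B) u u"
    using eigenvalue_count_split[OF A transpose_penalized(3) subspace_Ker assms, of C] by metis
  obtain U where U: "subspace U" "dim U = dim X + rank C" "U \<inter> Ker C \<subseteq> X"
    by (rule Ker_complement[OF C(1) X(1,2)])
  have "form (B - (- s) *\<^sub>R A) u u < 0" if "u \<in> U" "u \<in> Ker C" "u \<noteq> 0" for u
  proof -
    have "s * form A u u < form (- B) u u" using X(4) U(3) that by blast
    then show ?thesis unfolding form_matrix_simps by simp
  qed
  then have "\<forall>\<^sub>F t in at_top. \<forall>u\<in>U. u \<noteq> 0 \<longrightarrow> form (B - (- s) *\<^sub>R A) u u < t * form C u u"
    by (intro penalty_dominates C U(1))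
  then show ?thesis
  proof eventually_elim
    case (elim t)
    have "s * form A u u < form (- (B - t *\<^sub>R C)) u u" if "u \<in> U" "u \<noteq> 0" for u
      using elim that unfolding form_matrix_simps by fastforce
    then have "dim U \<le> count_pos (form_space UNIV (form A) (form (- (B - t *\<^sub>R C)))) s"
      by (intro dim_le_count_pos[OF A transpose_penalized(2) subspace_UNIV assms U(1)]) auto
    then show ?case using U(2) X(3) by simp
  qed
qed

lemma form_penalized_Ker: "u \<in> Ker C \<Longrightarrow> form (B - t *\<^sub>R C) v u = form B v u"
  by (simp add: form_matrix_simps) (simp add: form_def Ker_def)

lemma count_pos_penalized_ge:
  assumes "0 \<le> s"
  shows "count_pos (form_space (Ker C) (form A) (form B)) s
    \<le> count_pos (form_space UNIV (form A) (form (B - t *\<^sub>R C))) s"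
proof -
  obtain X where X: "subspace X" "X \<subseteq> Ker C"
    "dim X = count_pos (form_space (Ker C) (form A) (form B)) s"
    "\<And>u. u \<in> X \<Longrightarrow> u \<noteq> 0 \<Longrightarrow> s * form A u u < form B u u"
    using eigenvalue_count_split[OF A B subspace_Ker assms, of C] by metis
  have "s * form A u u < form (B - t *\<^sub>R C) u u" if "u \<in> X" "u \<noteq> 0" for u
    using X(2,4) that form_penalized_Ker[of u t u] by auto
  then show ?thesis unfolding X(3)[symmetric]
    by (intro dim_le_count_pos[OF A transpose_penalized(1) subspace_UNIV assms X(1)]) auto
qed

lemma count_neg_penalized_le:
  assumes "0 \<le> s'" "s' < s"
  shows "count_pos (form_space UNIV (form A) (form (- (B - t *\<^sub>R C)))) s
    \<le> rank C + count_pos (form_space (Ker C) (form A) (form (- B))) s'"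
proof -
  obtain Y where Y: "subspace Y" "Y \<subseteq> Ker C"
    "dim Y + count_pos (form_space (Ker C) (form A) (form (- B))) s' = dim (Ker C)"
    "\<And>u. u \<in> Y \<Longrightarrow> form (- B) u u \<le> s' * form A u u"
    using eigenvalue_count_split[OF A transpose_penalized(3) subspace_Ker assms(1), of C] by metis
  have "form (- (B - t *\<^sub>R C)) u u \<le> s * form A u u" if "u \<in> Y" "u \<noteq> 0" for u
  proof -
    have "form (- (B - t *\<^sub>R C)) u u = form (- B) u u"
      using Y(2) that form_penalized_Ker[of u t u] unfolding form_matrix_minus by auto
    also have "\<dots> \<le> s' * form A u u" using Y(4) that by blast
    also have "\<dots> \<le> s * form A u u" using assms pos_def_form[OF A(2) that(2)] by simp
    finally show ?thesis .
  qed
  then have "count_pos (form_space UNIV (form A) (form (- (B - t *\<^sub>R C)))) s + dim Y \<le> dim (UNIV :: (real^'n) set)"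
    using assms by (intro count_pos_le_codim[OF A transpose_penalized(2) subspace_UNIV _ Y(1)]) auto
  then show ?thesis using Y(3) dim_Ker[OF C(1)] by simp
qed

lemma num_pos_penalized_ge:
  assumes BC: "Ker B \<inter> Ker C = {0}"
  shows "num_pos (form_space (Ker C) (form A) (form B)) + J_inf B C
    \<le> num_pos (form_space UNIV (form A) (form (B - t *\<^sub>R C)))"
proof -
  obtain X where X: "subspace X" "X \<subseteq> Ker C"
    "dim X = num_pos (form_space (Ker C) (form A) (form B))"
    "\<And>u. u \<in> X \<Longrightarrow> u \<noteq> 0 \<Longrightarrow> 0 < form B u u"
    using eigenvalue_count_split[OF A B subspace_Ker order_refl, of C]
    unfolding count_pos_0 by (metis mult_zero_left)
  obtain Y where Y: "subspace Y"
    "dim Y + num_pos (form_space UNIV (form A) (form (B - t *\<^sub>R C))) = dim (UNIV :: (real^'n) set)"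
    "\<And>u. u \<in> Y \<Longrightarrow> form (B - t *\<^sub>R C) u u \<le> 0"
    "\<And>u v. u \<in> Y \<Longrightarrow> form (B - t *\<^sub>R C) u u = 0 \<Longrightarrow> form (B - t *\<^sub>R C) u v = 0"
    using eigenvalue_count_split[OF A transpose_penalized(1) subspace_UNIV order_refl, of t]
    unfolding count_pos_0 by (metis mult_zero_left UNIV_I)
  \<comment> \<open>On \<open>Y\<close> the form of \<open>B - t C\<close> is nonpositive, and its null vectors there lie in the kernel of \<open>B - t C\<close>;
    hence \<open>Y\<close> meets \<open>X + N\<close> only in \<open>Ker B \<inter> Ker C\<close>.\<close>
  define N where "N = {u \<in> Ker C. \<forall>v\<in>Ker C. form B u v = 0}"
  have N: "subspace N" using subspace_Ker[of C] unfolding N_def subspace_def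
    by (auto simp: form_add_left form_scale_left)
  have XN: "x = 0" if "x \<in> X" "x \<in> N" for x
    using that X(2) X(4)[of x] by (force simp: N_def)
  let ?W = "{x + y |x y. x \<in> X \<and> y \<in> N}"
  have "X \<inter> N \<subseteq> {0}" using XN by blast
  then have "dim (X \<inter> N) = 0" by (simp only: dim_eq_0)
  then have dimW: "dim ?W = dim X + dim N" using dim_sums_Int[OF X(1) N] by linarith
  have WY: "w = 0" if "w \<in> ?W" and wY: "w \<in> Y" for w
  proof -
    obtain x n where w: "w = x + n" "x \<in> X" "n \<in> N" using \<open>w \<in> ?W\<close> by blast
    have wK: "w \<in> Ker C" using w X(2) subspace_Ker[of C] by (auto simp: N_def intro: subspace_add)
    have "form B x n = 0" "form B n x = 0" "form B n n = 0"
      using w X(2) form_commute[OF B, of x n] by (auto simp: N_def)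
    then have "form B x x = form B w w" by (simp add: w(1) form_add_left form_add_right)
    moreover have w_form: "form B w w = form (B - t *\<^sub>R C) w w" by (simp add: form_penalized_Ker[OF wK])
    ultimately have "x = 0" using X(4)[OF w(2)] Y(3)[OF wY] by fastforce
    then have "form B w w = 0" using w(1) \<open>form B n n = 0\<close> by simp
    then have "form (B - t *\<^sub>R C) w v = 0" for v using Y(4)[OF wY] w_form by simp
    then have "form B v w = 0" for v
      using form_commute[OF transpose_penalized(1), of t w v] form_penalized_Ker[OF wK, of t v] by simp
    then have "form B (B *v w) w = 0" by blast
    then have "w \<in> Ker B" by (simp add: form_def Ker_def)
    then show ?thesis using wK BC by blast
  qed
  have "dim ?W + dim Y \<le> dim (UNIV :: (real^'n) set)"
    using WY by (intro dim_add_le_of_trivial_Int subspace_sums X(1) N Y(1)) auto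
  then show ?thesis using Y(2) dimW X(3) by (simp add: J_inf_def N_def)
qed

end

theorem proposition4p1:
  fixes A B C :: "real^'n^'n"
    and P :: "real \<Rightarrow> real \<Rightarrow> (real^'n) set"
    and L :: "real \<Rightarrow> (real^'n) set"
  defines "P \<equiv> \<lambda>t. pencil_space A (B - t *\<^sub>R C)"
    and "L \<equiv> form_space (Ker C) (form A) (form B)"
  assumes "transpose A = A" and "transpose B = B" and "transpose C = C"
    and "pos_def A" and "pos_semidef C" and "C \<noteq> 0" and "Ker C \<noteq> {0}"
    and "Ker B \<inter> Ker C = {0}"
  shows
    "(\<forall>j. num_pos L + 1 \<le> j \<and> j \<le> num_pos L + J_inf B C \<longrightarrow>
        (\<forall>\<^sub>F t in at_top. j \<le> num_pos (P t)) \<and>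
        filterlim (\<lambda>t. pos_eig (P t) j) at_top at_top) \<and>
     (\<forall>j. 1 \<le> j \<and> j \<le> num_pos L \<longrightarrow>
        (\<forall>\<^sub>F t in at_top. j \<le> num_pos (P t)) \<and>
        ((\<lambda>t. pos_eig (P t) j) \<longlongrightarrow> pos_eig L j) at_top) \<and>
     (\<forall>j. 1 \<le> j \<and> j \<le> rank C \<longrightarrow>
        (\<forall>\<^sub>F t in at_top. j \<le> num_neg (P t)) \<and>
        ((\<lambda>t. neg_eig (P t) j) \<longlongrightarrow> 0) at_top) \<and>
     (\<forall>j. rank C + 1 \<le> j \<and> j \<le> rank C + num_neg L \<longrightarrow>
        (\<forall>\<^sub>F t in at_top. j \<le> num_neg (P t)) \<and>
        ((\<lambda>t. neg_eig (P t) j) \<longlongrightarrow> neg_eig L (j - rank C)) at_top)"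
proof -
  note ctx = assms(3,6,4,5,7)
  define P' where "P' t = form_space UNIV (form A) (form (- (B - t *\<^sub>R C)))" for t
  define L' where "L' = form_space (Ker C) (form A) (form (- B))"
  have P: "P t = form_space UNIV (form A) (form (B - t *\<^sub>R C))" for t
    unfolding P_def
    by (rule pencil_space_eq_form_space[OF assms(3) transpose_penalized(1)[OF ctx]])
  have Pm: "(\<lambda>l. P t (- l)) = P' t" for t by (rule ext) (simp add: P P'_def form_space_uminus)
  have Lm: "(\<lambda>l. L (- l)) = L'" by (rule ext) (simp add: L_def L'_def form_space_uminus)
  note num_neg = num_neg_uminus[of "P _", unfolded Pm] num_neg_uminus[of L, unfolded Lm]
  have neg_limit: "(\<forall>\<^sub>F t in at_top. j \<le> num_neg (P t)) \<and> ((\<lambda>t. neg_eig (P t) j) \<longlongrightarrow> - m) at_top"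
    if "1 \<le> j" and lim: "(\<forall>\<^sub>F t in at_top. j \<le> num_pos (P' t)) \<and> ((\<lambda>t. pos_eig (P' t) j) \<longlongrightarrow> m) at_top"
    for j m
  proof
    show ex: "\<forall>\<^sub>F t in at_top. j \<le> num_neg (P t)" using lim by (simp add: num_neg)
    have "\<forall>\<^sub>F t in at_top. - pos_eig (P' t) j = neg_eig (P t) j"
      using ex by eventually_elim (simp add: neg_eig_uminus[OF that(1)] Pm)
    then show "((\<lambda>t. neg_eig (P t) j) \<longlongrightarrow> - m) at_top"
      using tendsto_minus lim by (blast intro: Lim_transform_eventually)
  qed
  have "(\<forall>\<^sub>F t in at_top. j \<le> num_pos (P t)) \<and> filterlim (\<lambda>t. pos_eig (P t) j) at_top at_top"
    if j: "num_pos L + 1 \<le> j" "j \<le> num_pos L + J_inf B C" for j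
  proof
    have "j \<le> num_pos (P t)" for t
      using num_pos_penalized_ge[OF ctx assms(10), of t] j(2) unfolding P L_def by (rule le_trans[rotated])
    then show ex: "\<forall>\<^sub>F t in at_top. j \<le> num_pos (P t)" by simp
    show "filterlim (\<lambda>t. pos_eig (P t) j) at_top at_top"
    proof (rule pos_eig_at_top[OF _ ex])
      fix s :: real assume "0 < s"
      from count_pos_penalized_le[OF ctx order_refl this]
      show "\<forall>\<^sub>F t in at_top. count_pos (P t) s < j"
        by eventually_elim (use j(1) in \<open>simp add: P L_def count_pos_0\<close>)
    qed (use j in simp)
  qed
  moreover have "(\<forall>\<^sub>F t in at_top. j \<le> num_pos (P t)) \<and> ((\<lambda>t. pos_eig (P t) j) \<longlongrightarrow> pos_eig L j) at_top"
    if j: "1 \<le> j" "j \<le> num_pos L" for j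
  proof (rule pos_eig_tendsto[OF j(1) j])
    fix s :: real assume "0 \<le> s" "j \<le> count_pos L s"
    then have "j \<le> count_pos (P t) s" for t
      using count_pos_penalized_ge[OF ctx, of s t] by (simp add: P L_def)
    then show "\<forall>\<^sub>F t in at_top. j \<le> count_pos (P t) s" by simp
  next
    fix s s' :: real assume "0 \<le> s'" "s' < s" and less: "count_pos L s' < j"
    from count_pos_penalized_le[OF ctx this(1,2)]
    show "\<forall>\<^sub>F t in at_top. count_pos (P t) s < j"
      by eventually_elim (use less in \<open>simp add: P L_def\<close>)
  qed
  moreover have "(\<forall>\<^sub>F t in at_top. j \<le> num_neg (P t)) \<and> ((\<lambda>t. neg_eig (P t) j) \<longlongrightarrow> 0) at_top"
    if j: "1 \<le> j" "j \<le> rank C" for j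
  proof -
    have "(\<forall>\<^sub>F t in at_top. j \<le> num_pos (P' t)) \<and> ((\<lambda>t. pos_eig (P' t) j) \<longlongrightarrow> 0) at_top"
    proof (rule pos_eig_tendsto_0[OF j(1)])
      fix s :: real assume "0 \<le> s"
      from count_neg_penalized_ge[OF ctx this]
      show "\<forall>\<^sub>F t in at_top. j \<le> count_pos (P' t) s"
        by eventually_elim (use j(2) in \<open>simp add: P'_def\<close>)
    qed
    from neg_limit[OF j(1) this] show ?thesis by simp
  qed
  moreover have "(\<forall>\<^sub>F t in at_top. j \<le> num_neg (P t)) \<and>
      ((\<lambda>t. neg_eig (P t) j) \<longlongrightarrow> neg_eig L (j - rank C)) at_top"
    if j: "rank C + 1 \<le> j" "j \<le> rank C + num_neg L" for j
  proof -
    let ?i = "j - rank C"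
    have i: "1 \<le> ?i" "?i \<le> num_pos L'" and j1: "1 \<le> j" using j by (simp_all add: num_neg)
    have "(\<forall>\<^sub>F t in at_top. j \<le> num_pos (P' t)) \<and> ((\<lambda>t. pos_eig (P' t) j) \<longlongrightarrow> pos_eig L' ?i) at_top"
    proof (rule pos_eig_tendsto[OF j1 i])
      fix s :: real assume "0 \<le> s" and le: "?i \<le> count_pos L' s"
      from count_neg_penalized_ge[OF ctx this(1)]
      show "\<forall>\<^sub>F t in at_top. j \<le> count_pos (P' t) s"
        by eventually_elim (use le in \<open>simp add: P'_def L'_def\<close>)
    next
      fix s s' :: real assume s: "0 \<le> s'" "s' < s" and less: "count_pos L' s' < ?i"
      have "count_pos (P' t) s < j" for t
        using count_neg_penalized_le[OF ctx s, of t] less by (simp add: P'_def L'_def)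
      then show "\<forall>\<^sub>F t in at_top. count_pos (P' t) s < j" by simp
    qed
    from neg_limit[OF j1 this] show ?thesis
      using neg_eig_uminus[OF i(1), of L] i(2) by (simp add: Lm num_neg)
  qed
  ultimately show ?thesis by blast
qed

end
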